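(* Assume that the equation $x'=A_3(t)x^{n_3}+A_2(t)x^{n_2}+A_1(t)x^{n_1}$ satisfies (ND). Let $x_1=1/p_1(t)$ and $x_2=1/p_2(t)$ be two distinct nonconstant rational solutions, labeled so that $\deg p_2\le\deg p_1$. If $a_1<(n_1-1)\deg(p_1)-1$ and $a_2=(n_2-1)\deg(p_1)-1$, then necessarily $a_3=(n_3-1)\deg(p_1)-1$. Consequently $\deg(p_1)=r_{32}=r_{2\partial}=r_{3\partial}$ and $T_{\deg(p_1)}=\{3,2,\partial\}$; moreover, $\deg(p_2)=\deg(p_1)$. In particular, cases $(r_{31})$, $(r_{21})$ and $(r_{1\partial})$ cannot occur for any other nonconstant rational solution.
   Context: Setting. $\Bbbk\in\{\mathbb{R},\mathbb{C}\}$; $n_1,n_2,n_3$ are natural numbers with $1<n_1<n_2<n_3$; $A_1,A_2,A_3\in\Bbbk[t]$ are nonzero, $a_i:=\deg A_i$, and $\alpha_i\in\Bbbk^\times$ is the leading coefficient of $A_i$. Every nonconstant rational solution of the equation has the form $x=1/p(t)$ with $p\in\Bbbk[t]$, $\deg p\ge1$. Tie sets and edge polynomials. The symbol $\partial$ is an extra index (encoding the derivative term), with $a_\partial=-1$, $n_\partial=1$. For $r\in\mathbb{N}_{>0}$ set $\Phi_i(r)=n_ir-a_i$ ($i=1,2,3$), $\Phi_\partial(r)=r+1$, $O_r=\min\{\Phi_\ell(r):\ell\in\{3,2,1,\partial\}\}$ and $T_r=\{\ell\in\{3,2,1,\partial\}:\Phi_\ell(r)=O_r\}$. The value $r$ is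 edge-admissible if $|T_r|\ge2$; then its edge polynomial is $P_r(C)=\sum_{\ell\in T_r\cap\{3,2,1\}}\alpha_\ell C^{n_\ell}+\mathbf{1}_{\{\partial\in T_r\}}\,rC$. Candidate degrees. $r_{32}=\frac{a_3-a_2}{n_3-n_2}$, $r_{31}=\frac{a_3-a_1}{n_3-n_1}$, $r_{21}=\frac{a_2-a_1}{n_2-n_1}$, $r_{i\partial}=\frac{a_i+1}{n_i-1}$ ($i=1,2,3$), $r_0=\frac{a_3}{n_3-n_2}$, and $\Gamma=\{r_{32},r_{31},r_{21},r_{3\partial},r_{2\partial},r_{1\partial}\}\cap\mathbb{N}\cap(0,r_0]$. Cases. For $i,j\in\{3,2,1,\partial\}$ distinct, "case $(r_{ij})$ occurs for the solution $1/p$" means that $\deg p=r_{ij}$ and the tie $\{i,j\}$ holds there: with $D_\ell(p)=a_\ell+(n_3-n_\ell)\deg p$, one has $D_i(p)=D_j(p)\ge D_k(p)$ for all $k\in\{3,2,1,\partial\}$ (equivalently, $i,j\in T_{\deg p}$). Hypothesis (ND). For every edge-admissible $r\in\Gamma$, with $e_r$ the multiplicity of $0$ as a root of $P_r$ and $\widetilde P_r(C)=P_r(C)/C^{e_r}$: (ND1) $\operatorname{Res}_C(\widetilde P_r(C),\widetilde P_r'(C))\ne0$, i.e. $\widetilde P_r$ has only simple roots; (ND2) if $\partial\in T_r$, then $P_r'(C)\notin\mathbb{Z}_{<0}$ for every nonzero root $C\in\Bbbk$ of $P_r$; (ND3) (a) if $\Bbbk=\mathbb{C}$: $\operatorname{Res}_C(\widetilde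 P_r(C),\widetilde P_r(C/\zeta))\ne0$ for every $\zeta\in(\mu_{n_3-n_2}\cup\mu_{n_3-n_1}\cup\mu_{n_3-1})\setminus\{1\}$, where $\mu_m=\{\zeta\in\mathbb{C}^\times:\zeta^m=1\}$; (b) if $\Bbbk=\mathbb{R}$: $\operatorname{Res}_C(\widetilde P_r(C),\widetilde P_r(-C))\ne0$ whenever at least one of $n_3-n_2$, $n_3-n_1$, $n_3-1$ is even (no condition if all three are odd). *)

theory Defs
  imports
    Complex_Main
    "HOL-Computational_Algebra.Computational_Algebra"
    "Subresultants.Resultant_Prelim"
begin

section \<open>Rational functions and the equation\<close>

text \<open>Rational functions over \<open>k\<close> are elements of the fraction field \<open>k(t)\<close>, i.e. of
  \<open>'a poly fract\<close>; the derivative is the formal one, given by the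
  quotient rule; \<open>fract_deriv_Fract\<close> below shows that it does not depend on the representation.\<close>

definition fract_deriv :: "'a::field poly fract \<Rightarrow> 'a poly fract" where
  "fract_deriv x = (THE y. \<exists>a b. b \<noteq> 0 \<and> x = Fraction_Field.Fract a b
     \<and> y = Fraction_Field.Fract (pderiv a * b - a * pderiv b) (b ^ 2))"

lemma fract_deriv_Fract:
  fixes a b :: "'a::field poly"
  assumes b: "b \<noteq> 0"
  shows "fract_deriv (Fraction_Field.Fract a b)
     = Fraction_Field.Fract (pderiv a * b - a * pderiv b) (b ^ 2)"
  unfolding fract_deriv_def
proof (rule the_equality)
  show "\<exists>a' b'. b' \<noteq> 0 \<and> Fraction_Field.Fract a b = Fraction_Field.Fract a' b'
      \<and> Fraction_Field.Fract (pderiv a * b - a * pderiv b) (b ^ 2)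
        = Fraction_Field.Fract (pderiv a' * b' - a' * pderiv b') (b' ^ 2)"
    using b by blast
next
  fix y
  assume "\<exists>c d. d \<noteq> 0 \<and> Fraction_Field.Fract a b = Fraction_Field.Fract c d
      \<and> y = Fraction_Field.Fract (pderiv c * d - c * pderiv d) (d ^ 2)"
  then obtain c d where d: "d \<noteq> 0" and "Fraction_Field.Fract a b = Fraction_Field.Fract c d"
    and y: "y = Fraction_Field.Fract (pderiv c * d - c * pderiv d) (d ^ 2)" by blast
  then have eq: "a * d = c * b" using b by (simp add: eq_fract)
  then have "pderiv (a * d) = pderiv (c * b)" by simp
  then have deq: "a * pderiv d + d * pderiv a = c * pderiv b + b * pderiv c"
    by (simp add: pderiv_mult)
  have "(pderiv a * b - a * pderiv b) * d^2 - (pderiv c * d - c * pderiv d) * b^2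
      = b * d * ((a * pderiv d + d * pderiv a) - (c * pderiv b + b * pderiv c))
        - (a * d - c * b) * (b * pderiv d + d * pderiv b)"
    by (simp add: algebra_simps power2_eq_square)
  also have "\<dots> = 0" using eq deq by simp
  finally show "y = Fraction_Field.Fract (pderiv a * b - a * pderiv b) (b ^ 2)"
    using b d by (simp add: y eq_fract)
qed

datatype idx3 = I1 | I2 | I3

text \<open>The equation is given by its exponents \<open>n\<close> and coefficients \<open>A\<close>, indexed by \<open>{1, 2, 3}\<close>.\<close>

definition rational_solution ::
    "(idx3 \<Rightarrow> nat) \<Rightarrow> (idx3 \<Rightarrow> 'a::field poly) \<Rightarrow> 'a poly fract \<Rightarrow> bool" where
  "rational_solution n A x \<longleftrightarrow>
     fract_deriv x = to_fract (A I3) * x ^ n I3 + to_fract (A I2) * x ^ n I2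
                       + to_fract (A I1) * x ^ n I1"

definition constant_fract :: "'a::field poly fract \<Rightarrow> bool" where
  "constant_fract x \<longleftrightarrow> (\<exists>c. x = to_fract [:c:])"

definition nonconst_solution ::
    "(idx3 \<Rightarrow> nat) \<Rightarrow> (idx3 \<Rightarrow> 'a::field poly) \<Rightarrow> 'a poly fract \<Rightarrow> bool" where
  "nonconst_solution n A x \<longleftrightarrow> rational_solution n A x \<and> \<not> constant_fract x"

section \<open>Tie sets and edge polynomials\<close>

text \<open>\<open>Der\<close> is the extra index \<open>\<partial>\<close>, with \<open>a\<^sub>\<partial> = -1\<close> and \<open>n\<^sub>\<partial> = 1\<close>.\<close>

datatype idx = Pow idx3 | Der

definition all_idx :: "idx set" where
  "all_idx = {Pow I3, Pow I2, Pow I1, Der}"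

fun expo :: "(idx3 \<Rightarrow> nat) \<Rightarrow> idx \<Rightarrow> int" where
  "expo n (Pow i) = int (n i)"
| "expo n Der = 1"

fun cdeg :: "(idx3 \<Rightarrow> 'a::zero poly) \<Rightarrow> idx \<Rightarrow> int" where
  "cdeg A (Pow i) = int (degree (A i))"
| "cdeg A Der = -1"

text \<open>For \<open>l = Der\<close> this reads \<open>r + 1\<close>.\<close>

definition Phi :: "(idx3 \<Rightarrow> nat) \<Rightarrow> (idx3 \<Rightarrow> 'a::zero poly) \<Rightarrow> idx \<Rightarrow> nat \<Rightarrow> int" where
  "Phi n A l r = expo n l * int r - cdeg A l"

definition min_order :: "(idx3 \<Rightarrow> nat) \<Rightarrow> (idx3 \<Rightarrow> 'a::zero poly) \<Rightarrow> nat \<Rightarrow> int" where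
  "min_order n A r = Min ((\<lambda>l. Phi n A l r) ` all_idx)"

definition tie_set :: "(idx3 \<Rightarrow> nat) \<Rightarrow> (idx3 \<Rightarrow> 'a::zero poly) \<Rightarrow> nat \<Rightarrow> idx set" where
  "tie_set n A r = {l \<in> all_idx. Phi n A l r = min_order n A r}"

definition edge_admissible :: "(idx3 \<Rightarrow> nat) \<Rightarrow> (idx3 \<Rightarrow> 'a::zero poly) \<Rightarrow> nat \<Rightarrow> bool" where
  "edge_admissible n A r \<longleftrightarrow> card (tie_set n A r) \<ge> 2"

definition edge_poly ::
    "(idx3 \<Rightarrow> nat) \<Rightarrow> (idx3 \<Rightarrow> 'a::field poly) \<Rightarrow> nat \<Rightarrow> 'a poly" where
  "edge_poly n A r =
     (\<Sum>i | Pow i \<in> tie_set n A r. monom (lead_coeff (A i)) (n i))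
     + (if Der \<in> tie_set n A r then monom (of_nat r) 1 else 0)"

definition edge_poly_red ::
    "(idx3 \<Rightarrow> nat) \<Rightarrow> (idx3 \<Rightarrow> 'a::field poly) \<Rightarrow> nat \<Rightarrow> 'a poly" where
  "edge_poly_red n A r =
     edge_poly n A r div [:0, 1:] ^ Polynomial.order 0 (edge_poly n A r)"

section \<open>Candidate degrees and cases\<close>

text \<open>For \<open>j = Der\<close> this is \<open>(a\<^sub>i + 1) / (n\<^sub>i - 1)\<close>.\<close>

definition cand :: "(idx3 \<Rightarrow> nat) \<Rightarrow> (idx3 \<Rightarrow> 'a::zero poly) \<Rightarrow> idx \<Rightarrow> idx \<Rightarrow> real" where
  "cand n A i j = of_int (cdeg A i - cdeg A j) / of_int (expo n i - expo n j)"

definition cand_max :: "(idx3 \<Rightarrow> nat) \<Rightarrow> (idx3 \<Rightarrow> 'a::zero poly) \<Rightarrow> real" where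
  "cand_max n A = real (degree (A I3)) / (real (n I3) - real (n I2))"

definition Gamma_set :: "(idx3 \<Rightarrow> nat) \<Rightarrow> (idx3 \<Rightarrow> 'a::zero poly) \<Rightarrow> nat set" where
  "Gamma_set n A =
     {r. real r \<in> {cand n A (Pow I3) (Pow I2), cand n A (Pow I3) (Pow I1),
                   cand n A (Pow I2) (Pow I1), cand n A (Pow I3) Der,
                   cand n A (Pow I2) Der, cand n A (Pow I1) Der}
         \<and> 0 < r \<and> real r \<le> cand_max n A}"

definition Ddeg ::
    "(idx3 \<Rightarrow> nat) \<Rightarrow> (idx3 \<Rightarrow> 'a::zero poly) \<Rightarrow> idx \<Rightarrow> 'a poly \<Rightarrow> int" where
  "Ddeg n A l p = cdeg A l + (int (n I3) - expo n l) * int (degree p)"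

definition case_occurs ::
    "(idx3 \<Rightarrow> nat) \<Rightarrow> (idx3 \<Rightarrow> 'a::zero poly) \<Rightarrow> idx \<Rightarrow> idx \<Rightarrow> 'a poly \<Rightarrow> bool" where
  "case_occurs n A i j p \<longleftrightarrow>
     real (degree p) = cand n A i j \<and> Ddeg n A i p = Ddeg n A j p
     \<and> (\<forall>k \<in> all_idx. Ddeg n A k p \<le> Ddeg n A j p)"

section \<open>The nondegeneracy hypothesis\<close>

definition ND1 :: "(idx3 \<Rightarrow> nat) \<Rightarrow> (idx3 \<Rightarrow> 'a::field poly) \<Rightarrow> nat \<Rightarrow> bool" where
  "ND1 n A r \<longleftrightarrow> resultant (edge_poly_red n A r) (pderiv (edge_poly_red n A r)) \<noteq> 0"

definition ND2 :: "(idx3 \<Rightarrow> nat) \<Rightarrow> (idx3 \<Rightarrow> 'a::field poly) \<Rightarrow> nat \<Rightarrow> bool" where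
  "ND2 n A r \<longleftrightarrow>
     (Der \<in> tie_set n A r \<longrightarrow>
       (\<forall>C. C \<noteq> 0 \<and> poly (edge_poly n A r) C = 0 \<longrightarrow>
          poly (pderiv (edge_poly n A r)) C \<notin> of_int ` {z::int. z < 0}))"

definition ND3_complex :: "(idx3 \<Rightarrow> nat) \<Rightarrow> (idx3 \<Rightarrow> complex poly) \<Rightarrow> nat \<Rightarrow> bool" where
  "ND3_complex n A r \<longleftrightarrow>
     (\<forall>\<zeta>. (\<zeta> ^ (n I3 - n I2) = 1 \<or> \<zeta> ^ (n I3 - n I1) = 1 \<or> \<zeta> ^ (n I3 - 1) = 1) \<and> \<zeta> \<noteq> 1 \<longrightarrow>
        resultant (edge_poly_red n A r) (pcompose (edge_poly_red n A r) [:0, 1 / \<zeta>:]) \<noteq> 0)"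

definition ND3_real :: "(idx3 \<Rightarrow> nat) \<Rightarrow> (idx3 \<Rightarrow> real poly) \<Rightarrow> nat \<Rightarrow> bool" where
  "ND3_real n A r \<longleftrightarrow>
     (even (n I3 - n I2) \<or> even (n I3 - n I1) \<or> even (n I3 - 1) \<longrightarrow>
        resultant (edge_poly_red n A r) (pcompose (edge_poly_red n A r) [:0, -1:]) \<noteq> 0)"

definition ND_complex :: "(idx3 \<Rightarrow> nat) \<Rightarrow> (idx3 \<Rightarrow> complex poly) \<Rightarrow> bool" where
  "ND_complex n A \<longleftrightarrow>
     (\<forall>r \<in> Gamma_set n A. edge_admissible n A r \<longrightarrow> ND1 n A r \<and> ND2 n A r \<and> ND3_complex n A r)"

definition ND_real :: "(idx3 \<Rightarrow> nat) \<Rightarrow> (idx3 \<Rightarrow> real poly) \<Rightarrow> bool" where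
  "ND_real n A \<longleftrightarrow>
     (\<forall>r \<in> Gamma_set n A. edge_admissible n A r \<longrightarrow> ND1 n A r \<and> ND2 n A r \<and> ND3_real n A r)"

end

theory Submission
  imports Defs
begin

text \<open>
  With \<open>x = 1/p\<close> the equation becomes
  \<open>A\<^sub>3 + A\<^sub>2 p\<^bsup>n\<^sub>3-n\<^sub>2\<^esup> + A\<^sub>1 p\<^bsup>n\<^sub>3-n\<^sub>1\<^esup> + p' p\<^bsup>n\<^sub>3-2\<^esup> = 0\<close>, so
  \<open>p\<^bsup>n\<^sub>3-n\<^sub>2\<^esup>\<close> divides \<open>A\<^sub>3\<close>, which gives the bound \<open>deg p \<le> r\<^sub>0\<close> in the definition of \<open>\<Gamma>\<close>,
  and the highest degree among the four terms is attained at least twice.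
  Let \<open>r = deg p\<^sub>1\<close>. If \<open>A\<^sub>3\<close> had smaller degree than the terms \<open>2\<close> and \<open>\<partial>\<close>, then
  \<open>P\<^sub>r(C) = \<alpha>\<^sub>2 C\<^bsup>n\<^sub>2\<^esup> + r C\<close> would vanish at the inverse \<open>C\<close> of the leading coefficient of
  \<open>p\<^sub>1\<close>, with \<open>P\<^sub>r'(C) = -(n\<^sub>2 - 1) r\<close>, contradicting (ND2).
  In a degree below \<open>r\<close> the term \<open>A\<^sub>3\<close> alone would dominate, and in degrees at least \<open>r\<close> the term
  \<open>1\<close> lies strictly below the term \<open>\<partial>\<close>; so no solution has degree below \<open>r\<close>,
  and no tie involves the index \<open>1\<close>.
\<close>

section \<open>The polynomial equation for \<open>p\<close> and the degrees of its terms\<close>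

lemma to_fract_power: "to_fract (a ^ k) = to_fract a ^ k"
  by (induction k) simp_all

text \<open>Multiply the equation for \<open>x = 1/p\<close> by \<open>p ^ n I3\<close>, using that
  the derivative of \<open>1/p\<close> is \<open>- p' / p^2\<close>.\<close>

lemma nonconst_solution_inverse_poly:
  fixes A :: "idx3 \<Rightarrow> 'a::field_char_0 poly"
  assumes n: "1 < n I1" "n I1 < n I2" "n I2 < n I3"
    and sol: "nonconst_solution n A (1 / to_fract p)"
  shows "0 < degree p"
    and "A I3 + A I2 * p ^ (n I3 - n I2) + A I1 * p ^ (n I3 - n I1) + pderiv p * p ^ (n I3 - 2) = 0"
proof -
  have nc: "\<not> constant_fract (1 / to_fract p)"
    and eq: "fract_deriv (1 / to_fract p) = to_fract (A I3) * (1 / to_fract p) ^ n I3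
      + to_fract (A I2) * (1 / to_fract p) ^ n I2 + to_fract (A I1) * (1 / to_fract p) ^ n I1"
    using sol by (auto simp: nonconst_solution_def rational_solution_def)
  show "0 < degree p"
  proof (rule ccontr)
    assume "\<not> 0 < degree p"
    then obtain c where p: "p = [:c:]"
      using degree_eq_zeroE by blast
    have "1 / to_fract p = to_fract [:1 / c:]"
    \<comment> \<open>For \<open>c = 0\<close> both sides are 0, since division by zero gives 0; so
      \<open>p = 0\<close> is excluded as well.\<close>
    proof (cases "c = 0")
      case False
      then have "to_fract [:1 / c:] * to_fract p = to_fract 1"
        unfolding to_fract_mult [symmetric] by (simp add: p one_pCons)
      then show ?thesis
        using False p by (simp add: field_simps)
    qed (simp add: p)
    then show False
      using nc by (auto simp: constant_fract_def)
  qed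
  then have p0: "p \<noteq> 0"
    by auto
  define P where "P = to_fract p"
  have P0: "P \<noteq> 0"
    using p0 by (simp add: P_def)
  have "fract_deriv (1 / P) = - to_fract (pderiv p) / P ^ 2"
    using fract_deriv_Fract [OF p0, of 1] p0
    by (simp add: P_def Fract_conv_to_fract power2_eq_square)
  then have "- to_fract (pderiv p) / P ^ 2 * P ^ n I3 = (to_fract (A I3) * (1 / P) ^ n I3
      + to_fract (A I2) * (1 / P) ^ n I2 + to_fract (A I1) * (1 / P) ^ n I1) * P ^ n I3"
    using eq by (simp add: P_def)
  moreover have cancel: "x * (1 / P) ^ k * P ^ n I3 = x * P ^ (n I3 - k)" if "k \<le> n I3" for x k
    using P0 that by (simp add: power_diff power_divide)
  moreover have "- to_fract (pderiv p) / P ^ 2 * P ^ n I3 = - to_fract (pderiv p) * P ^ (n I3 - 2)"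
    using cancel [of 2 "- to_fract (pderiv p)"] n by (simp add: power_divide)
  ultimately have "to_fract (A I3) + to_fract (A I2) * P ^ (n I3 - n I2)
      + to_fract (A I1) * P ^ (n I3 - n I1) + to_fract (pderiv p) * P ^ (n I3 - 2) = 0"
    using n cancel [of "n I3" "to_fract (A I3)"] cancel [of "n I2" "to_fract (A I2)"]
      cancel [of "n I1" "to_fract (A I1)"]
    by (simp add: distrib_right)
  then have "to_fract (A I3 + A I2 * p ^ (n I3 - n I2) + A I1 * p ^ (n I3 - n I1)
      + pderiv p * p ^ (n I3 - 2)) = 0"
    by (simp add: P_def to_fract_power)
  then show "A I3 + A I2 * p ^ (n I3 - n I2) + A I1 * p ^ (n I3 - n I1)
      + pderiv p * p ^ (n I3 - 2) = 0"
    by (simp only: to_fract_eq_0_iff)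
qed

text \<open>Identifies \<open>Ddeg\<close> with term degrees in the polynomial equation. For
  \<open>i = I3\<close> the power of \<open>p\<close> is 1, which covers the bare term
  \<open>A I3\<close>.\<close>

lemma degree_mult_power_eq_Ddeg:
  fixes A :: "idx3 \<Rightarrow> 'a::field_char_0 poly"
  assumes "A i \<noteq> 0" "0 < degree p" "n i \<le> n I3"
  shows "int (degree (A i * p ^ (n I3 - n i))) = Ddeg n A (Pow i) p"
proof -
  have "p \<noteq> 0"
    using assms by auto
  then show ?thesis
    using assms by (simp add: Ddeg_def degree_mult_eq degree_power_eq of_nat_diff)
qed

text \<open>In characteristic 0 differentiation lowers the degree of \<open>p\<close> by exactly 1;
  this is the convention that \<open>Der\<close> has coefficient degree -1 and exponent 1.\<close>

lemma degree_pderiv_mult_power_eq_Ddeg: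
  fixes A :: "idx3 \<Rightarrow> 'a::field_char_0 poly"
  assumes "0 < degree p" "2 \<le> n I3"
  shows "int (degree (pderiv p * p ^ (n I3 - 2))) = Ddeg n A Der p"
proof -
  have "p \<noteq> 0" "pderiv p \<noteq> 0"
    using assms by (auto simp: pderiv_eq_0_iff)
  moreover obtain k m where "degree p = Suc k" "n I3 = Suc (Suc m)"
    using assms by (metis add_2_eq_Suc gr0_conv_Suc le_Suc_ex)
  ultimately show ?thesis
    by (simp add: Ddeg_def degree_mult_eq degree_power_eq degree_pderiv algebra_simps)
qed

text \<open>\<open>A I3\<close> is minus the sum of the other three terms. Taking \<open>M\<close>
  one below its degree shows that \<open>A I3\<close> cannot dominate alone.\<close>

lemma solution_degree_A3_le:
  fixes A :: "idx3 \<Rightarrow> 'a::field_char_0 poly"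
  assumes n: "1 < n I1" "n I1 < n I2" "n I2 < n I3"
    and A: "\<forall>i. A i \<noteq> 0"
    and sol: "nonconst_solution n A (1 / to_fract p)"
    and M: "Ddeg n A (Pow I2) p \<le> M" "Ddeg n A (Pow I1) p \<le> M" "Ddeg n A Der p \<le> M"
  shows "int (degree (A I3)) \<le> M"
proof -
  note sol = nonconst_solution_inverse_poly [OF n sol]
  define B2 B1 B0 where "B2 = A I2 * p ^ (n I3 - n I2)" and "B1 = A I1 * p ^ (n I3 - n I1)"
    and "B0 = pderiv p * p ^ (n I3 - 2)"
  have deg: "int (degree B2) \<le> M" "int (degree B1) \<le> M" "int (degree B0) \<le> M"
    using M A n sol(1) degree_mult_power_eq_Ddeg [of A I2 p n] degree_mult_power_eq_Ddeg [of A I1 p n]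
      degree_pderiv_mult_power_eq_Ddeg [of p n A]
    by (simp_all add: B2_def B1_def B0_def)
  have "A I3 = - (B2 + B1 + B0)"
    using sol(2) by (simp only: B2_def B1_def B0_def eq_neg_iff_add_eq_0 add.assoc)
  then have "degree (A I3) = degree (B2 + B1 + B0)"
    by (simp only: degree_minus)
  \<comment> \<open>\<open>deg\<close> forces \<open>M\<close> to be nonnegative, so
    \<open>nat M\<close> truncates nothing.\<close>
  also have "\<dots> \<le> nat M"
    using deg by (intro degree_add_le) auto
  finally show ?thesis
    using deg by linarith
qed

lemma solution_degree_le_cand_max:
  fixes A :: "idx3 \<Rightarrow> 'a::field_char_0 poly"
  assumes n: "1 < n I1" "n I1 < n I2" "n I2 < n I3"
    and A: "A I3 \<noteq> 0"
    and sol: "nonconst_solution n A (1 / to_fract p)"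
  shows "real (degree p) \<le> cand_max n A"
proof -
  note sol = nonconst_solution_inverse_poly [OF n sol]
  define q where "q = p ^ (n I3 - n I2)"
  \<comment> \<open>\<open>n I3 - n I2\<close> is the least of the three exponents of
    \<open>p\<close>.\<close>
  have "q dvd p ^ (n I3 - n I1)" "q dvd p ^ (n I3 - 2)"
    unfolding q_def using n by (auto intro!: le_imp_power_dvd)
  then have "q dvd A I2 * q + A I1 * p ^ (n I3 - n I1) + pderiv p * p ^ (n I3 - 2)"
    by (intro dvd_add dvd_mult) auto
  moreover have "A I3 = - (A I2 * q + A I1 * p ^ (n I3 - n I1) + pderiv p * p ^ (n I3 - 2))"
    using sol(2) by (simp only: q_def eq_neg_iff_add_eq_0 add.assoc)
  ultimately have "q dvd A I3"
    by (simp only: dvd_minus_iff)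
  then have "degree q \<le> degree (A I3)"
    using A by (rule dvd_imp_degree_le)
  then have "degree p * (n I3 - n I2) \<le> degree (A I3)"
    using sol(1) by (subst (asm) q_def, subst (asm) degree_power_eq) (auto simp: mult.commute)
  then have "real (degree p * (n I3 - n I2)) \<le> real (degree (A I3))"
    by (simp only: of_nat_le_iff)
  then show ?thesis
    using n by (simp add: cand_max_def field_simps of_nat_diff)
qed

section \<open>Tie sets and consequences of (ND2)\<close>

lemma mem_tie_set_iff:
  "l \<in> tie_set n A r \<longleftrightarrow> l \<in> all_idx \<and> (\<forall>k\<in>all_idx. Phi n A l r \<le> Phi n A k r)"
proof -
  have "finite all_idx"
    by (simp add: all_idx_def)
  then show ?thesis
    unfolding tie_set_def min_order_def
    by (auto intro!: Min_eqI [symmetric])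
qed

text \<open>For \<open>r = degree p\<close>, \<open>Phi\<close> equals \<open>n I3 * r\<close> minus
  \<open>Ddeg\<close>, so the least \<open>Phi\<close> belongs to the terms of largest
  degree.\<close>

lemma tie_set_2Der:
  assumes "Phi n A (Pow I2) r = Phi n A Der r"
    and "Phi n A Der r < Phi n A (Pow I3) r" "Phi n A Der r < Phi n A (Pow I1) r"
  shows "tie_set n A r = {Pow I2, Der}"
  using assms by (auto simp: mem_tie_set_iff all_idx_def)

lemma tie_set_32Der:
  assumes "Phi n A (Pow I2) r = Phi n A Der r"
    and "Phi n A (Pow I3) r = Phi n A Der r" "Phi n A Der r < Phi n A (Pow I1) r"
  shows "tie_set n A r = {Pow I3, Pow I2, Der}"
  using assms by (auto simp: mem_tie_set_iff all_idx_def)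

text \<open>Only the terms 2 and \<open>Der\<close> reach the top degree, so their leading
  coefficients cancel; a common power of \<open>lead_coeff p\<close> is then divided out.\<close>

lemma solution_lead_coeff_2Der:
  fixes A :: "idx3 \<Rightarrow> 'a::field_char_0 poly"
  assumes n: "1 < n I1" "n I1 < n I2" "n I2 < n I3"
    and A: "\<forall>i. A i \<noteq> 0"
    and sol: "nonconst_solution n A (1 / to_fract p)"
    and D: "Ddeg n A (Pow I2) p = Ddeg n A Der p" "Ddeg n A (Pow I1) p < Ddeg n A Der p"
      "Ddeg n A (Pow I3) p < Ddeg n A Der p"
  shows "lead_coeff (A I2) + of_nat (degree p) * lead_coeff p ^ (n I2 - 1) = 0"
proof -
  note sol = nonconst_solution_inverse_poly [OF n sol]
  define B2 B1 B0 where "B2 = A I2 * p ^ (n I3 - n I2)" and "B1 = A I1 * p ^ (n I3 - n I1)"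
    and "B0 = pderiv p * p ^ (n I3 - 2)"
  define N where "N = degree B0"
  have p: "lead_coeff p \<noteq> 0"
    using sol(1) by auto
  have N: "int N = Ddeg n A Der p"
    using n sol(1) by (simp add: N_def B0_def degree_pderiv_mult_power_eq_Ddeg)
  have "degree B2 = N" "degree B1 < N" "degree (A I3) < N"
    using N D A n sol(1) degree_mult_power_eq_Ddeg [of A I2 p n]
      degree_mult_power_eq_Ddeg [of A I1 p n] degree_mult_power_eq_Ddeg [of A I3 p n]
    by (simp_all add: B2_def B1_def)
  then have "lead_coeff B2 + lead_coeff B0 = coeff (A I3 + B2 + B1 + B0) N"
    by (simp add: N_def coeff_eq_0)
  also have "\<dots> = 0"
    using sol(2) by (simp add: B2_def B1_def B0_def)
  finally have "lead_coeff (A I2) * lead_coeff p ^ (n I3 - n I2)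
      + of_nat (degree p) * lead_coeff p * lead_coeff p ^ (n I3 - 2) = 0"
    using sol(1)
    by (simp add: B2_def B0_def lead_coeff_mult lead_coeff_power degree_pderiv coeff_pderiv)
  moreover have "lead_coeff p * lead_coeff p ^ (n I3 - 2)
      = lead_coeff p ^ (n I2 - 1) * lead_coeff p ^ (n I3 - n I2)"
    using n by (simp add: numeral_2_eq_2 Suc_diff_Suc flip: power_Suc power_add)
  ultimately have "(lead_coeff (A I2) + of_nat (degree p) * lead_coeff p ^ (n I2 - 1))
      * lead_coeff p ^ (n I3 - n I2) = 0"
    by (simp add: algebra_simps)
  then show ?thesis
    using p by simp
qed

lemma edge_poly_2Der_not_ND2:
  fixes A :: "idx3 \<Rightarrow> 'a::field_char_0 poly"
  assumes T: "tie_set n A r = {Pow I2, Der}"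
    and r: "0 < r" and n2: "1 < n I2" and c: "c \<noteq> 0"
    and lead: "lead_coeff (A I2) + of_nat r * c ^ (n I2 - 1) = 0"
  shows "\<not> ND2 n A r"
proof -
  have E: "edge_poly n A r = monom (lead_coeff (A I2)) (n I2) + monom (of_nat r) 1"
    by (simp add: edge_poly_def T)
  have a: "lead_coeff (A I2) = - (of_nat r * c ^ (n I2 - 1))"
    using lead by (simp only: eq_neg_iff_add_eq_0)
  obtain m where m: "n I2 = Suc m" "0 < m"
    using n2 by (cases "n I2") auto
  have root: "poly (edge_poly n A r) (1 / c) = 0"
    using c unfolding E a by (simp add: poly_monom m power_divide)
  \<comment> \<open>After substituting \<open>a\<close>, the two monomials contribute
    \<open>- (m + 1) * r\<close> and \<open>r\<close>.\<close>
  have "poly (pderiv (edge_poly n A r)) (1 / c) = of_int (- (int m * int r))"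
    using c unfolding E a
    by (simp add: pderiv_add pderiv_monom poly_monom m power_divide algebra_simps)
  moreover have "- (int m * int r) < 0"
    using m r by simp
  ultimately have "poly (pderiv (edge_poly n A r)) (1 / c) \<in> of_int ` {z::int. z < 0}"
    by blast
  then show ?thesis
    using root c T unfolding ND2_def by (metis divide_eq_0_iff insertCI one_neq_zero)
qed

text \<open>Stated over any field of characteristic 0, with (ND2) as hypothesis, so that the real
  and the complex case are both instances.\<close>

lemma solution_ties:
  fixes A :: "idx3 \<Rightarrow> 'a::field_char_0 poly"
  assumes n: "1 < n I1" "n I1 < n I2" "n I2 < n I3"
    and A: "\<forall>i. A i \<noteq> 0"
    and ND: "\<forall>r\<in>Gamma_set n A. edge_admissible n A r \<longrightarrow> ND2 n A r"
    and sol1: "nonconst_solution n A (1 / to_fract p1)"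
    and sol2: "nonconst_solution n A (1 / to_fract p2)"
    and le: "degree p2 \<le> degree p1"
    and a1: "int (degree (A I1)) < (int (n I1) - 1) * int (degree p1) - 1"
    and a2: "int (degree (A I2)) = (int (n I2) - 1) * int (degree p1) - 1"
  shows "int (degree (A I3)) = (int (n I3) - 1) * int (degree p1) - 1
    \<and> real (degree p1) = cand n A (Pow I3) (Pow I2)
    \<and> cand n A (Pow I3) (Pow I2) = cand n A (Pow I2) Der
    \<and> cand n A (Pow I2) Der = cand n A (Pow I3) Der
    \<and> tie_set n A (degree p1) = {Pow I3, Pow I2, Der}
    \<and> degree p2 = degree p1
    \<and> (\<forall>p. nonconst_solution n A (1 / to_fract p) \<and> 1 / to_fract p \<noteq> 1 / to_fract p1 \<longrightarrow>
          \<not> case_occurs n A (Pow I3) (Pow I1) p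
          \<and> \<not> case_occurs n A (Pow I2) (Pow I1) p
          \<and> \<not> case_occurs n A (Pow I1) Der p)"
proof -
  define r where "r = degree p1"
  note a1 = a1 [folded r_def] and a2 = a2 [folded r_def]
  have r: "0 < r"
    using nonconst_solution_inverse_poly [OF n sol1] by (simp add: r_def)
  have r2: "real r = cand n A (Pow I2) Der"
  proof -
    have "real (degree (A I2)) = (real (n I2) - 1) * real r - 1"
      using a2 by (metis (mono_tags, lifting) of_int_1 of_int_diff of_int_mult of_int_of_nat_eq)
    then show ?thesis
      using n by (simp add: cand_def field_simps)
  qed
  have a3: "int (degree (A I3)) = (int (n I3) - 1) * int r - 1"
  proof (rule ccontr)
    assume ne: "\<not> ?thesis"
    \<comment> \<open>The terms 1 and 2 do not exceed the derivative term at \<open>p1\<close>,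
      hence neither does \<open>A I3\<close>; with \<open>ne\<close> the inequality is
      strict.\<close>
    have "int (degree (A I3)) \<le> Ddeg n A Der p1"
      using n A sol1
      by (rule solution_degree_A3_le) (use a1 a2 in \<open>simp_all add: Ddeg_def r_def algebra_simps\<close>)
    with ne have lt: "int (degree (A I3)) < (int (n I3) - 1) * int r - 1"
      by (simp add: Ddeg_def r_def)
    have T: "tie_set n A r = {Pow I2, Der}"
      using a1 a2 lt by (intro tie_set_2Der) (simp_all add: Phi_def algebra_simps)
    have "r \<in> Gamma_set n A"
      using r2 r solution_degree_le_cand_max [OF n _ sol1] A by (simp add: Gamma_set_def r_def)
    moreover have "edge_admissible n A r"
      by (simp add: edge_admissible_def T)
    ultimately have "ND2 n A r"
      using ND by blast
    moreover have "lead_coeff (A I2) + of_nat r * lead_coeff p1 ^ (n I2 - 1) = 0"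
      unfolding r_def using n A sol1
      by (rule solution_lead_coeff_2Der)
        (use a1 a2 lt in \<open>simp_all add: Ddeg_def r_def algebra_simps\<close>)
    then have "\<not> ND2 n A r"
      using T r n by (intro edge_poly_2Der_not_ND2 [where c = "lead_coeff p1"]) (auto simp: r_def)
    ultimately show False
      by blast
  qed
  have r3: "real r = cand n A (Pow I3) Der"
  proof -
    have "real (degree (A I3)) = (real (n I3) - 1) * real r - 1"
      using a3 by (metis (mono_tags, lifting) of_int_1 of_int_diff of_int_mult of_int_of_nat_eq)
    then show ?thesis
      using n by (simp add: cand_def field_simps)
  qed
  have r32: "real r = cand n A (Pow I3) (Pow I2)"
  proof -
    have "int (degree (A I3)) - int (degree (A I2)) = (int (n I3) - int (n I2)) * int r"
      using a2 a3 by (simp add: algebra_simps)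
    then have "cand n A (Pow I3) (Pow I2)
        = of_int ((int (n I3) - int (n I2)) * int r) / of_int (int (n I3) - int (n I2))"
      by (simp only: cand_def cdeg.simps expo.simps)
    then show ?thesis
      using n by simp
  qed
  have T: "tie_set n A r = {Pow I3, Pow I2, Der}"
    using a1 a2 a3 by (intro tie_set_32Der) (simp_all add: Phi_def algebra_simps)
  have ge: "r \<le> degree p" if "nonconst_solution n A (1 / to_fract p)" for p
  proof (rule ccontr)
    assume "\<not> r \<le> degree p"
    then have lt: "int (degree p) + 1 \<le> int r"
      by simp
    \<comment> \<open>At degree \<open>r\<close> no other term exceeds \<open>degree (A I3)\<close>.
      Each has positive slope \<open>k\<close> in the degree of \<open>p\<close>, so below
      \<open>r\<close> it loses at least 1.\<close>
    have *: "k * int (degree p) + 1 \<le> k * int r" if "0 < k" for k :: int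
      using mult_left_mono [OF lt, of k] that by (simp add: algebra_simps)
    have "int (degree (A I3)) \<le> int (degree (A I3)) - 1"
      using n A that
      by (rule solution_degree_A3_le)
        (use a1 a2 a3 n * [of "int (n I3) - int (n I2)"] * [of "int (n I3) - int (n I1)"]
          * [of "int (n I3) - 1"] in \<open>simp_all add: Ddeg_def algebra_simps\<close>)
    then show False
      by simp
  qed
  have no1: "Ddeg n A (Pow I1) p < Ddeg n A Der p"
    if "nonconst_solution n A (1 / to_fract p)" for p
  proof -
    \<comment> \<open>The gap between the terms \<open>Der\<close> and 1 has slope
      \<open>n I1 - 1\<close> in the degree of \<open>p\<close> and is already positive at
      \<open>r\<close> by \<open>a1\<close>.\<close>
    have "(int (n I1) - 1) * int r \<le> (int (n I1) - 1) * int (degree p)"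
      using ge [OF that] n by (intro mult_left_mono) auto
    then show ?thesis
      using a1 by (simp add: Ddeg_def algebra_simps)
  qed
  \<comment> \<open>Each of these cases would give term 1 the maximal degree, hence at least that of
    \<open>Der\<close>.\<close>
  have "\<not> case_occurs n A (Pow I3) (Pow I1) p
      \<and> \<not> case_occurs n A (Pow I2) (Pow I1) p
      \<and> \<not> case_occurs n A (Pow I1) Der p"
    if "nonconst_solution n A (1 / to_fract p)" for p
    using no1 [OF that] by (auto simp: case_occurs_def all_idx_def)
  moreover have "degree p2 = r"
    using le ge [OF sol2] by (simp add: r_def)
  ultimately show ?thesis
    unfolding r_def [symmetric] using a3 r2 r3 r32 T by simp
qed

theorem proposition5p6:
  fixes n :: "idx3 \<Rightarrow> nat"
  assumes "1 < n I1" and "n I1 < n I2" and "n I2 < n I3"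
  shows "(\<forall>(A :: idx3 \<Rightarrow> real poly) (x1 :: real poly fract) (x2 :: real poly fract)
           (p1 :: real poly) (p2 :: real poly).
          (\<forall>i. A i \<noteq> 0) \<and> ND_real n A
          \<and> x1 = 1 / to_fract p1 \<and> x2 = 1 / to_fract p2
          \<and> nonconst_solution n A x1 \<and> nonconst_solution n A x2
          \<and> x1 \<noteq> x2 \<and> degree p2 \<le> degree p1
          \<and> int (degree (A I1)) < (int (n I1) - 1) * int (degree p1) - 1
          \<and> int (degree (A I2)) = (int (n I2) - 1) * int (degree p1) - 1
          \<longrightarrow>
          int (degree (A I3)) = (int (n I3) - 1) * int (degree p1) - 1
          \<and> real (degree p1) = cand n A (Pow I3) (Pow I2)
          \<and> cand n A (Pow I3) (Pow I2) = cand n A (Pow I2) Der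
          \<and> cand n A (Pow I2) Der = cand n A (Pow I3) Der
          \<and> tie_set n A (degree p1) = {Pow I3, Pow I2, Der}
          \<and> degree p2 = degree p1
          \<and> (\<forall>p. nonconst_solution n A (1 / to_fract p) \<and> 1 / to_fract p \<noteq> x1 \<longrightarrow>
                \<not> case_occurs n A (Pow I3) (Pow I1) p
                \<and> \<not> case_occurs n A (Pow I2) (Pow I1) p
                \<and> \<not> case_occurs n A (Pow I1) Der p))
      \<and>
      (\<forall>(A :: idx3 \<Rightarrow> complex poly) (x1 :: complex poly fract) (x2 :: complex poly fract)
           (p1 :: complex poly) (p2 :: complex poly).
          (\<forall>i. A i \<noteq> 0) \<and> ND_complex n A
          \<and> x1 = 1 / to_fract p1 \<and> x2 = 1 / to_fract p2
          \<and> nonconst_solution n A x1 \<and> nonconst_solution n A x2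
          \<and> x1 \<noteq> x2 \<and> degree p2 \<le> degree p1
          \<and> int (degree (A I1)) < (int (n I1) - 1) * int (degree p1) - 1
          \<and> int (degree (A I2)) = (int (n I2) - 1) * int (degree p1) - 1
          \<longrightarrow>
          int (degree (A I3)) = (int (n I3) - 1) * int (degree p1) - 1
          \<and> real (degree p1) = cand n A (Pow I3) (Pow I2)
          \<and> cand n A (Pow I3) (Pow I2) = cand n A (Pow I2) Der
          \<and> cand n A (Pow I2) Der = cand n A (Pow I3) Der
          \<and> tie_set n A (degree p1) = {Pow I3, Pow I2, Der}
          \<and> degree p2 = degree p1
          \<and> (\<forall>p. nonconst_solution n A (1 / to_fract p) \<and> 1 / to_fract p \<noteq> x1 \<longrightarrow>
                \<not> case_occurs n A (Pow I3) (Pow I1) p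
                \<and> \<not> case_occurs n A (Pow I2) (Pow I1) p
                \<and> \<not> case_occurs n A (Pow I1) Der p))"
  by (intro conjI; intro allI impI; elim conjE; hypsubst;
      rule solution_ties [OF assms]; simp add: ND_real_def ND_complex_def)

end
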